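(* Let $\lambda_j$ denote those (complex) eigenvalues of $BA$ that are different from $-\alpha$. Then the Shifted BA Iteration $$x^{k+1}=(1-\alpha\,\omega)\,x^k+\omega\,B\,(b-A\,x^k),\qquad k=0,1,2,\ldots,$$ converges to a fixed point if and only if $\alpha$ and $\omega$ satisfy, for all these $\lambda_j$, $$0<\omega<2\,\frac{\mathrm{Re}(\lambda_j)+\alpha}{|\lambda_j|^2+\alpha\,(\alpha+2\,\mathrm{Re}(\lambda_j))}\qquad\text{and}\qquad \mathrm{Re}(\lambda_j)+\alpha>0 .$$
   Context: Here $A\in\mathbb{R}^{m\times n}$, $B\in\mathbb{R}^{n\times m}$ (both $m\ge n$ and $m<n$ are allowed, and $B$ need not equal $A^T$), $b\in\mathbb{R}^m$, and the two parameters of the iteration are $\alpha>0$ and $\omega>0$. The iterates $x^k$ are vectors in $\mathbb{R}^n$. $\mathrm{Re}(\lambda)$ is the real part of $\lambda\in\mathbb{C}$, and $I$ is the $n\times n$ identity matrix. A fixed point of the iteration is a vector $x\in\mathbb{R}^n$ with $x=(1-\alpha\omega)x+\omega B(b-Ax)$, equivalently $(BA+\alpha I)x=Bb$.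
   Formalization: Convergence is meant for every starting vector x^0; if −α is an eigenvalue of BA, it is additionally assumed that −α is semisimple and that a fixed point exists, since otherwise the "if" direction fails (e.g. A=[-1], B=[1], b=1, α=1). *)

theory Defs
  imports "HOL-Analysis.Analysis"
begin

definition eigenvalue :: "'a::field^'n^'n \<Rightarrow> 'a \<Rightarrow> bool" where
  "eigenvalue M c \<longleftrightarrow> (\<exists>v. v \<noteq> 0 \<and> M *v v = c *s v)"

text \<open>
  An eigenvalue is semisimple (non-defective) if it has no generalised eigenvectors beyond the
  eigenvectors, i.e. if its algebraic and geometric multiplicities agree.
\<close>

definition semisimple_eigenvalue :: "'a::field^'n^'n \<Rightarrow> 'a \<Rightarrow> bool" where
  "semisimple_eigenvalue M c \<longleftrightarrow> eigenvalue M c \<and>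
     (\<forall>v. (M - mat c) *v ((M - mat c) *v v) = 0 \<longrightarrow> (M - mat c) *v v = 0)"

abbreviation complex_matrix :: "real^'n^'m \<Rightarrow> complex^'n^'m" where
  "complex_matrix \<equiv> map_matrix complex_of_real"

definition shifted_BA_step ::
  "real^'n^'m \<Rightarrow> real^'m^'n \<Rightarrow> real^'m \<Rightarrow> real \<Rightarrow> real \<Rightarrow> real^'n \<Rightarrow> real^'n" where
  "shifted_BA_step A B b \<alpha> \<omega> x = (1 - \<alpha> * \<omega>) *\<^sub>R x + \<omega> *\<^sub>R (B *v (b - A *v x))"

primrec shifted_BA ::
  "real^'n^'m \<Rightarrow> real^'m^'n \<Rightarrow> real^'m \<Rightarrow> real \<Rightarrow> real \<Rightarrow> real^'n \<Rightarrow> nat \<Rightarrow> real^'n" where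
  "shifted_BA A B b \<alpha> \<omega> x0 0 = x0"
| "shifted_BA A B b \<alpha> \<omega> x0 (Suc k) = shifted_BA_step A B b \<alpha> \<omega> (shifted_BA A B b \<alpha> \<omega> x0 k)"

definition shifted_BA_fixed_point ::
  "real^'n^'m \<Rightarrow> real^'m^'n \<Rightarrow> real^'m \<Rightarrow> real \<Rightarrow> real \<Rightarrow> real^'n \<Rightarrow> bool" where
  "shifted_BA_fixed_point A B b \<alpha> \<omega> x \<longleftrightarrow> x = shifted_BA_step A B b \<alpha> \<omega> x"

end

theory Submission
  imports Defs "HOL-Computational_Algebra.Fundamental_Theorem_Algebra"
begin

text \<open>
  Measured from a fixed point, the iteration becomes the orbit \<open>e, G e, G\<^sup>2 e, \<dots>\<close> of the matrix
  \<open>G = (1 - \<alpha>\<omega>) I - \<omega> B A\<close>, and real orbits are the real parts of complex ones. The eigenvalues of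
  \<open>G\<close> are the numbers \<open>1 - \<omega> (\<lambda> + \<alpha>)\<close> with \<open>\<lambda>\<close> an eigenvalue of \<open>B A\<close>; the exceptional value
  \<open>\<lambda> = -\<alpha>\<close> corresponds to \<open>1\<close>, and for the other ones the two inequalities of the theorem say
  exactly that \<open>\<bar>1 - \<omega> (\<lambda> + \<alpha>)\<bar> < 1\<close> (lemma \<open>iteration_eigenvalue_in_unit_disc_iff\<close>).

  These eigenvalues must lie in the open unit disc, because an eigenvector for \<open>m\<close> has the orbit
  \<open>m\<^sup>k v\<close>, and \<open>m\<^sup>k\<close> converges only if \<open>m = 1\<close> or \<open>\<bar>m\<bar> < 1\<close>.

  Conversely, let all eigenvalues of a complex matrix \<open>T\<close> lie in the open unit disc, apart from a
  semisimple eigenvalue \<open>1\<close>. That all orbits of \<open>T\<close> converge (lemma \<open>orbits_convergent\<close>) is shown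
  without the Jordan normal form. The vectors with a convergent orbit form a subspace \<open>W\<close>, and it
  suffices that \<open>(T - l) v \<in> W\<close> implies \<open>v \<in> W\<close> for every complex \<open>l\<close>: some nonzero polynomial in
  \<open>T\<close> annihilates \<open>v\<close>, and its linear factors can be removed one at a time (lemma
  \<open>absorbing_subspace_eq_UNIV\<close>). The implication holds for three different reasons. If \<open>l\<close> is not
  an eigenvalue, \<open>T - l\<close> maps \<open>W\<close> bijectively onto itself. If \<open>\<bar>l\<bar> < 1\<close>, the orbit of \<open>v\<close> satisfies
  a contracting scalar recursion with a convergent perturbation. If \<open>l = 1\<close>, then \<open>T - 1\<close> is
  bijective on the vectors whose orbit tends to \<open>0\<close>, so \<open>v\<close> can be corrected by such a vector until
  \<open>(T - 1) v\<close> is fixed by \<open>T\<close>, whereupon semisimplicity makes the corrected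
  vector a fixed vector of \<open>T\<close>.

  A fixed point to measure from exists: it is assumed when \<open>-\<alpha>\<close> is an eigenvalue of \<open>B A\<close>, and
  otherwise \<open>I - G\<close> is invertible.
\<close>

section \<open>Polynomials in a matrix and absorbing subspaces\<close>

text \<open>
  This is \<open>p(T) v\<close>, computed by Horner's scheme on vectors, so that no matrix powers occur and the
  recursion follows the constructor \<open>pCons\<close>.
\<close>
definition poly_mat_vec :: "'a::field poly \<Rightarrow> 'a^'n^'n \<Rightarrow> 'a^'n \<Rightarrow> 'a^'n" where
  "poly_mat_vec p T v = fold_coeffs (\<lambda>a u. a *s v + T *v u) p 0"

lemma poly_mat_vec_0 [simp]: "poly_mat_vec 0 T v = 0"
  by (simp add: poly_mat_vec_def)

lemma poly_mat_vec_pCons [simp]: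
  "poly_mat_vec (pCons a p) T v = a *s v + T *v poly_mat_vec p T v"
  by (cases "p = 0 \<and> a = 0") (auto simp: poly_mat_vec_def)

lemma poly_mat_vec_add:
  "poly_mat_vec (p + q) T v = poly_mat_vec p T v + poly_mat_vec q T v"
  by (induction p q rule: poly_induct2)
     (simp_all add: vec.add vector_sadd_rdistrib)

lemma poly_mat_vec_smult: "poly_mat_vec (smult c p) T v = c *s poly_mat_vec p T v"
  by (induction p) (simp_all add: vec.scale vector_smult_assoc vector_add_ldistrib)

lemma poly_mat_vec_diff:
  "poly_mat_vec (p - q) T v = poly_mat_vec p T v - poly_mat_vec q T v"
  using poly_mat_vec_add[of p "smult (-1) q" T v]
  by (simp only: poly_mat_vec_smult) simp

lemma poly_mat_vec_sum:
  "poly_mat_vec (\<Sum>i\<in>I. f i) T v = (\<Sum>i\<in>I. poly_mat_vec (f i) T v)"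
  by (induction I rule: infinite_finite_induct) (simp_all add: poly_mat_vec_add)

lemma poly_mat_vec_monom: "poly_mat_vec (monom c i) T v = c *s (((*v) T ^^ i) v)"
  by (induction i) (simp_all add: monom_0 monom_Suc vec.scale)

lemma poly_mat_vec_linear_factor:
  "poly_mat_vec ([:- l, 1:] * q) T v = poly_mat_vec q T (T *v v - l *s v)"
proof -
  have "poly_mat_vec q T (T *v v - l *s v) = T *v poly_mat_vec q T v - l *s poly_mat_vec q T v"
    by (induction q)
       (simp_all add: vec.add vec.scale vec.diff vector_add_ldistrib vector_ssub_ldistrib
          vector_smult_assoc mult.commute)
  then show ?thesis
    by (simp add: poly_mat_vec_diff poly_mat_vec_smult)
qed

text \<open>
  The vectors \<open>v, T v, \<dots>, T\<^sup>d v\<close>, where \<open>d\<close> is the dimension, are too many to be independent.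
\<close>
lemma annihilating_poly_exists:
  fixes T :: "'a::field^'n^'n"
  obtains p where "p \<noteq> 0" "poly_mat_vec p T v = 0"
proof (cases "inj_on (\<lambda>i. ((*v) T ^^ i) v) {..CARD('n)}")
  case False
  then obtain i j where ij: "i \<noteq> j" "((*v) T ^^ i) v = ((*v) T ^^ j) v"
    by (auto simp: inj_on_def)
  have "coeff (monom 1 i - monom 1 j :: 'a poly) i \<noteq> 0"
    using ij(1) by simp
  then have "monom 1 i - monom 1 j \<noteq> (0 :: 'a poly)"
    by (metis coeff_0)
  moreover have "poly_mat_vec (monom 1 i - monom 1 j) T v = 0"
    using ij(2) by (simp add: poly_mat_vec_diff poly_mat_vec_monom)
  ultimately show thesis
    by (rule that)
next
  case True
  define S where "S = (\<lambda>i. ((*v) T ^^ i) v) ` {..CARD('n)}"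
  have "card S = Suc (CARD('n))"
    using True by (simp add: S_def card_image)
  moreover have "vec.dim S \<le> CARD('n)"
    using vec.dim_subset_UNIV[of S] by (simp add: vec.dimension_def card_cart_basis)
  ultimately have "vec.dependent S"
    by (intro vec.dependent_biggerset_general) simp
  then obtain u where u: "\<exists>w\<in>S. u w \<noteq> 0" "(\<Sum>w\<in>S. u w *s w) = 0"
    using vec.dependent_finite[of S] by (auto simp: S_def)
  define p where "p = (\<Sum>i\<le>CARD('n). monom (u (((*v) T ^^ i) v)) i)"
  have "coeff p i = u (((*v) T ^^ i) v)" if "i \<le> CARD('n)" for i
    using that by (simp add: p_def coeff_sum)
  with u(1) have "p \<noteq> 0"
    by (metis (no_types, lifting) S_def atMost_iff coeff_0 imageE)
  moreover have "poly_mat_vec p T v = (\<Sum>w\<in>S. u w *s w)"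
    using True by (simp add: p_def poly_mat_vec_sum poly_mat_vec_monom S_def sum.reindex)
  ultimately show thesis
    using u(2) that by simp
qed

text \<open>
  The hypothesis says that \<open>T\<close> has no eigenvalue on the quotient by \<open>W\<close>; over an algebraically
  closed field this forces the quotient to vanish. The quotient is avoided by peeling the linear
  factors off a polynomial that maps \<open>v\<close> into \<open>W\<close>.
\<close>
lemma absorbing_subspace_eq_UNIV:
  fixes T :: "'a::alg_closed_field^'n^'n"
  assumes W: "vec.subspace W"
    and absorb: "\<And>l v. T *v v - l *s v \<in> W \<Longrightarrow> v \<in> W"
  shows "W = UNIV"
proof -
  have "v \<in> W" if "p \<noteq> 0" "poly_mat_vec p T v \<in> W" for p v
    using that
  proof (induction "degree p" arbitrary: p v)
    case 0
    then obtain c where "p = [:c:]"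
      by (metis degree_eq_zeroE)
    with 0 have "c \<noteq> 0" "c *s v \<in> W"
      by auto
    then show ?case
      using vec.subspace_scale[OF W, of "c *s v" "inverse c"] by (simp add: vector_smult_assoc)
  next
    case (Suc d)
    then obtain l where "poly p l = 0"
      using alg_closed_imp_poly_has_root[of p] by auto
    then obtain q where q: "p = [:- l, 1:] * q"
      by (auto simp: poly_eq_0_iff_dvd)
    with Suc have "q \<noteq> 0"
      by auto
    then have "degree q = d"
      using Suc(2) degree_mult_eq[of "[:- l, 1:]" q] q by simp
    with \<open>q \<noteq> 0\<close> have "poly_mat_vec q T (T *v v - l *s v) \<in> W \<Longrightarrow> T *v v - l *s v \<in> W"
      using Suc(1) by blast
    then show ?case
      using Suc(4) absorb unfolding q poly_mat_vec_linear_factor by blast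
  qed
  then show ?thesis
    using annihilating_poly_exists vec.subspace_0[OF W] by (metis UNIV_eq_I)
qed

text \<open>
  An injective linear map preserves the dimension of \<open>W\<close>, so the image cannot be a proper subspace.
\<close>
lemma injective_on_invariant_subspace_imp_onto:
  fixes f :: "'a::field^'n \<Rightarrow> 'a^'n"
  assumes f: "Vector_Spaces.linear (*s) (*s) f" and W: "vec.subspace W"
    and invariant: "f ` W \<subseteq> W" and ker: "\<And>v. v \<in> W \<Longrightarrow> f v = 0 \<Longrightarrow> v = 0"
  shows "f ` W = W"
proof (rule vec.subspace_dim_equal)
  interpret f: Vector_Spaces.linear "(*s)" "(*s)" f by fact
  have "inj_on f W"
    using W ker by (auto simp: f.inj_on_iff_eq_0[OF W])
  then show "vec.dim (f ` W) \<ge> vec.dim W"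
    using vec.dim_image_eq[OF f, of W] W by (simp add: vec.span_eq_iff[THEN iffD2])
  show "vec.subspace (f ` W)"
    by (rule f.subspace_image[OF W])
qed (use W invariant in auto)

lemma linear_matrix_minus_scalar:
  "Vector_Spaces.linear (*s) (*s) (\<lambda>v. (T::'a::field^'n^'n) *v v - l *s v)"
  by unfold_locales
     (simp_all add: vec.add vec.scale vector_add_ldistrib vector_ssub_ldistrib
        vector_smult_assoc mult.commute)

section \<open>Convergence of the orbits of a complex matrix\<close>

lemma perturbed_geometric_recursion_tendsto_0:
  fixes a b :: "nat \<Rightarrow> 'a::real_normed_field"
  assumes l: "norm l < 1" and rec: "\<And>k. a (Suc k) = l * a k + b k" and b: "b \<longlonglongrightarrow> 0"
  shows "a \<longlonglongrightarrow> 0"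
proof (rule LIMSEQ_I)
  fix r :: real assume r: "r > 0"
  define s where "s = r / 2"
  have s: "s > 0" "s < r"
    using r by (auto simp: s_def)
  obtain K where K: "\<And>k. k \<ge> K \<Longrightarrow> norm (b k) < s * (1 - norm l)"
    using LIMSEQ_D[OF b, of "s * (1 - norm l)"] s l by auto
  \<comment> \<open>Past \<open>K\<close> the excess of \<open>norm (a k)\<close> over \<open>s\<close> shrinks by the factor \<open>norm l\<close> at each step.\<close>
  have bound: "norm (a (K + j)) - s \<le> norm l ^ j * norm (a K)" for j
  proof (induction j)
    case 0
    then show ?case using s by simp
  next
    case (Suc j)
    have "norm (a (K + Suc j)) \<le> norm l * norm (a (K + j)) + norm (b (K + j))"
      by (metis add_Suc_right norm_mult norm_triangle_ineq rec)
    also have "\<dots> \<le> norm l * norm (a (K + j)) + s * (1 - norm l)"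
      using K[of "K + j"] by simp
    also have "\<dots> = norm l * (norm (a (K + j)) - s) + s"
      by (simp add: algebra_simps)
    also have "\<dots> \<le> norm l * (norm l ^ j * norm (a K)) + s"
      using Suc by (intro add_right_mono mult_left_mono) auto
    finally show ?case by simp
  qed
  have "(\<lambda>j. norm l ^ j * norm (a K)) \<longlonglongrightarrow> 0"
    using tendsto_mult_left_zero[OF LIMSEQ_power_zero[of "norm l"]] l by simp
  then obtain J where J: "\<And>j. j \<ge> J \<Longrightarrow> norm l ^ j * norm (a K) < r - s"
    using LIMSEQ_D[of _ 0 "r - s"] s by fastforce
  show "\<exists>n0. \<forall>n\<ge>n0. norm (a n - 0) < r"
  proof (intro exI allI impI)
    fix n assume "n \<ge> K + J"
    then show "norm (a n - 0) < r"
      using bound[of "n - K"] J[of "n - K"] by (simp add: le_diff_conv2)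
  qed
qed

text \<open>
  The limit is the fixed point of \<open>x = l x + c\<close>; the distance to it obeys the same recursion with a
  perturbation that tends to \<open>0\<close>.
\<close>
lemma perturbed_geometric_recursion_convergent:
  fixes a b :: "nat \<Rightarrow> 'a::real_normed_field"
  assumes l: "norm l < 1" and rec: "\<And>k. a (Suc k) = l * a k + b k" and b: "b \<longlonglongrightarrow> c"
  shows "a \<longlonglongrightarrow> c / (1 - l)"
proof -
  have "1 - l \<noteq> 0"
    using l by auto
  then have "a (Suc k) - c / (1 - l) = l * (a k - c / (1 - l)) + (b k - c)" for k
    by (simp add: rec field_simps)
  moreover have "(\<lambda>k. b k - c) \<longlonglongrightarrow> 0"
    using b by (simp add: LIM_zero)
  ultimately have "(\<lambda>k. a k - c / (1 - l)) \<longlonglongrightarrow> 0"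
    using perturbed_geometric_recursion_tendsto_0[OF l, of "\<lambda>k. a k - c / (1 - l)" "\<lambda>k. b k - c"]
    by simp
  then show ?thesis
    by (rule LIM_zero_cancel)
qed

abbreviation orbit :: "'a::semiring_1^'n^'n \<Rightarrow> 'a^'n \<Rightarrow> nat \<Rightarrow> 'a^'n" where
  "orbit T v k \<equiv> ((*v) T ^^ k) v"

lemma orbit_add: "orbit T (v + w) k = orbit T v k + orbit T w k"
  for T :: "'a::field^'n^'n"
  by (induction k) (simp_all add: vec.add)

lemma orbit_scale: "orbit T (c *s v) k = c *s orbit T v k"
  for T :: "'a::field^'n^'n"
  by (induction k) (simp_all add: vec.scale)

lemma orbit_diff: "orbit T (v - w) k = orbit T v k - orbit T w k"
  for T :: "'a::field^'n^'n"
  by (induction k) (simp_all add: vec.diff)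

lemma orbit_step: "orbit T (T *v v) k = orbit T v (Suc k)"
  by (simp add: funpow_swap1)

lemma orbit_eigenvector: "T *v v = l *s v \<Longrightarrow> orbit T v k = l ^ k *s v"
  for T :: "'a::field^'n^'n"
  by (induction k) (simp_all add: vec.scale vector_smult_assoc mult.commute)

lemma tendsto_vector_scale:
  fixes f :: "'b \<Rightarrow> 'a::real_normed_field^'n"
  assumes "(f \<longlongrightarrow> a) F"
  shows "((\<lambda>x. c *s f x) \<longlongrightarrow> c *s a) F"
  by (rule vec_tendstoI) (auto intro!: tendsto_intros assms)

lemma orbit_limit_fixed:
  fixes T :: "complex^'n^'n"
  assumes "orbit T v \<longlonglongrightarrow> L"
  shows "T *v L = L"
proof -
  have "(\<lambda>k. T *v orbit T v k) \<longlonglongrightarrow> T *v L"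
    using assms by (rule bounded_linear.tendsto[OF matrix_vector_mul_bounded_linear])
  moreover have "(\<lambda>k. T *v orbit T v k) \<longlonglongrightarrow> L"
    using LIMSEQ_Suc[OF assms] by simp
  ultimately show ?thesis
    by (rule LIMSEQ_unique)
qed

lemma orbit_fixed: "T *v v = v \<Longrightarrow> orbit T v k = v"
  by (induction k) simp_all

lemma subspace_orbit_convergent:
  fixes T :: "complex^'n^'n"
  shows "vec.subspace {v. convergent (orbit T v)}"
proof (rule vec.subspaceI)
  fix c and x
  assume "x \<in> {v. convergent (orbit T v)}"
  then show "c *s x \<in> {v. convergent (orbit T v)}"
    unfolding orbit_scale convergent_def by (auto simp: orbit_scale intro: tendsto_vector_scale)
qed (auto simp: orbit_add orbit_fixed convergent_const intro: convergent_add)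

lemma subspace_orbit_null:
  fixes T :: "complex^'n^'n"
  shows "vec.subspace {v. orbit T v \<longlonglongrightarrow> 0}"
proof (rule vec.subspaceI)
  fix c and x
  assume "x \<in> {v. orbit T v \<longlonglongrightarrow> 0}"
  then show "c *s x \<in> {v. orbit T v \<longlonglongrightarrow> 0}"
    using tendsto_vector_scale[of "orbit T x" 0 sequentially c] by (simp add: orbit_scale)
qed (auto simp: orbit_add orbit_fixed intro: tendsto_add_zero)

text \<open>
  The subspace \<open>W\<close> of vectors with a convergent orbit absorbs every factor \<open>T - l\<close>, so it is the
  whole space. Semisimplicity of \<open>1\<close> excludes a Jordan block at \<open>1\<close>, along which orbits would grow
  linearly.
\<close>
lemma orbits_convergent:
  fixes T :: "complex^'n^'n"
  assumes spectrum: "\<And>l. eigenvalue T l \<Longrightarrow> l = 1 \<or> cmod l < 1"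
    and semisimple: "eigenvalue T 1 \<Longrightarrow> semisimple_eigenvalue T 1"
  shows "convergent (orbit T v)"
proof -
  let ?W = "{v. convergent (orbit T v)}" and ?N = "{v. orbit T v \<longlonglongrightarrow> 0}"
  have T_W: "T *v v \<in> ?W" if "v \<in> ?W" for v
    using that unfolding mem_Collect_eq orbit_step by (subst convergent_Suc_iff)
  have T_N: "T *v v \<in> ?N" if "v \<in> ?N" for v
    using that unfolding mem_Collect_eq orbit_step by (rule LIMSEQ_Suc)
  have "?W = UNIV"
  proof (rule absorbing_subspace_eq_UNIV[of _ T])
    show "vec.subspace ?W"
      by (rule subspace_orbit_convergent)
  next
    fix l v
    assume asm: "T *v v - l *s v \<in> ?W"
    consider "\<not> eigenvalue T l" | "cmod l < 1" | "eigenvalue T l" "l = 1"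
      using spectrum by blast
    then show "v \<in> ?W"
    proof cases
      case 1
      then have inj: "T *v u - l *s u = 0 \<Longrightarrow> u = 0" for u
        unfolding eigenvalue_def by auto
      have "(\<lambda>v. T *v v - l *s v) ` ?W = ?W"
        using T_W inj
        by (intro injective_on_invariant_subspace_imp_onto linear_matrix_minus_scalar
              subspace_orbit_convergent)
           (auto intro!: vec.subspace_diff[OF subspace_orbit_convergent, simplified]
              vec.subspace_scale[OF subspace_orbit_convergent, simplified])
      with asm obtain u where u: "u \<in> ?W" "T *v u - l *s u = T *v v - l *s v"
        by (metis (mono_tags, lifting) imageE)
      \<comment> \<open>\<open>T - l\<close> is injective on the whole space, so the preimage \<open>u\<close> found in \<open>W\<close> is \<open>v\<close>.\<close>
      have "T *v (u - v) - l *s (u - v) = (T *v u - l *s u) - (T *v v - l *s v)"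
        by (simp add: vec.diff vector_ssub_ldistrib)
      with u(2) have "u = v"
        using inj[of "u - v"] by simp
      with u(1) show ?thesis by simp
    next
      case 2
      obtain L where L: "orbit T (T *v v - l *s v) \<longlonglongrightarrow> L"
        using asm by (auto simp: convergent_def)
      have "orbit T v \<longlonglongrightarrow> (\<chi> i. L $ i / (1 - l))"
      proof (rule vec_tendstoI)
        fix i
        \<comment> \<open>The recursion is \<open>T\<^sup>k\<close> applied to \<open>T v = l v + (T v - l v)\<close>.\<close>
        have "orbit T v (Suc k) $ i = l * (orbit T v k $ i) + orbit T (T *v v - l *s v) k $ i" for k
          unfolding orbit_diff orbit_scale orbit_step by simp
        then show "(\<lambda>k. orbit T v k $ i) \<longlonglongrightarrow> (\<chi> i. L $ i / (1 - l)) $ i"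
          unfolding vec_lambda_beta
          by (rule perturbed_geometric_recursion_convergent[OF 2]) (rule tendsto_vec_nth[OF L])
      qed
      then show ?thesis
        by (auto simp: convergent_def)
    next
      case 3
      obtain L where L: "orbit T (T *v v - v) \<longlonglongrightarrow> L"
        using asm 3 by (auto simp: convergent_def)
      have TL: "T *v L = L"
        using orbit_limit_fixed[OF L] .
      have "(\<lambda>k. orbit T (T *v v - v) k - L) \<longlonglongrightarrow> 0"
        using L by (simp add: LIM_zero)
      then have null: "T *v v - v - L \<in> ?N"
        by (simp add: orbit_diff[where w = L] orbit_fixed[OF TL])
      have "(\<lambda>v. T *v v - 1 *s v) ` ?N = ?N"
      proof (intro injective_on_invariant_subspace_imp_onto linear_matrix_minus_scalar
          subspace_orbit_null)
        show "(\<lambda>v. T *v v - 1 *s v) ` ?N \<subseteq> ?N"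
          using T_N vec.subspace_diff[OF subspace_orbit_null] by auto
      next
        fix u assume u: "u \<in> ?N" "T *v u - 1 *s u = 0"
        then have "orbit T u \<longlonglongrightarrow> u"
          by (simp add: orbit_fixed)
        with u show "u = 0"
          using LIMSEQ_unique by blast
      qed
      with null obtain n where n: "n \<in> ?N" "T *v n - n = T *v v - v - L"
        by (smt (verit, best) imageE vector_smult_lid)
      \<comment> \<open>Removing the decaying part \<open>n\<close> leaves \<open>(T - 1) u = L\<close> with \<open>T L = L\<close>, so \<open>(T - 1)\<^sup>2 u = 0\<close>.\<close>
      define u where "u = v - n"
      have "T *v u - u = L"
        using n(2) by (simp add: u_def vec.diff algebra_simps)
      then have "(T - mat 1) *v u = L"
        by (simp add: matrix_vector_mult_diff_rdistrib)
      moreover have "(T - mat 1) *v L = 0"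
        using TL by (simp add: matrix_vector_mult_diff_rdistrib)
      ultimately have "L = 0"
        using semisimple 3 unfolding semisimple_eigenvalue_def by blast
      with \<open>T *v u - u = L\<close> have "T *v u = u"
        by simp
      then have "u \<in> ?W"
        by (simp add: orbit_fixed convergent_const)
      moreover have "n \<in> ?W"
        using n(1) by (auto simp: convergent_def)
      ultimately have "n + u \<in> ?W"
        by (intro vec.subspace_add[OF subspace_orbit_convergent])
      then show ?thesis
        by (simp add: u_def)
    qed
  qed
  then show ?thesis by auto
qed

text \<open>
  A limit \<open>L\<close> satisfies \<open>l L = L\<close>. If \<open>l \<noteq> 1\<close>, then \<open>L = 0\<close>, and some power of \<open>l\<close> has norm below \<open>1\<close>.
\<close>
lemma convergent_power_cases:
  fixes l :: "'a::real_normed_field"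
  assumes "convergent (\<lambda>k. l ^ k)"
  shows "l = 1 \<or> norm l < 1"
proof (cases "l = 1")
  case False
  obtain L where L: "(\<lambda>k. l ^ k) \<longlonglongrightarrow> L"
    using assms by (auto simp: convergent_def)
  have "(\<lambda>k. l * l ^ k) \<longlonglongrightarrow> l * L"
    by (intro tendsto_intros L)
  moreover have "(\<lambda>k. l * l ^ k) \<longlonglongrightarrow> L"
    using LIMSEQ_Suc[OF L] by simp
  ultimately have "L = 0"
    using False LIMSEQ_unique by fastforce
  with L obtain k where "norm (l ^ k) < 1"
    using LIMSEQ_D[of "\<lambda>k. l ^ k" 0 1] by fastforce
  then show ?thesis
    by (metis linorder_not_less norm_power one_le_power)
qed simp

section \<open>The iteration matrix of the shifted BA iteration\<close>

definition Re_vec :: "complex^'n \<Rightarrow> real^'n" where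
  "Re_vec z = (\<chi> i. Re (z $ i))"

lemma Re_vec_matrix_mult: "Re_vec (complex_matrix M *v z) = M *v Re_vec z"
  by (simp add: Re_vec_def matrix_vector_mult_def vec_eq_iff)

lemma Re_vec_of_real: "Re_vec (\<chi> i. complex_of_real (x $ i)) = x"
  by (simp add: Re_vec_def)

lemma tendsto_Re_vec: "(f \<longlongrightarrow> z) F \<Longrightarrow> ((\<lambda>x. Re_vec (f x)) \<longlongrightarrow> Re_vec z) F"
  unfolding Re_vec_def by (intro tendsto_intros)

lemma Re_vec_orbit: "Re_vec (orbit (complex_matrix M) z k) = orbit M (Re_vec z) k"
  by (induction k) (simp_all add: Re_vec_matrix_mult)

definition shifted_BA_matrix :: "real^'n^'m \<Rightarrow> real^'m^'n \<Rightarrow> real \<Rightarrow> real \<Rightarrow> real^'n^'n" where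
  "shifted_BA_matrix A B \<alpha> \<omega> = mat (1 - \<alpha> * \<omega>) - \<omega> *\<^sub>R (B ** A)"

lemma mat_vector_mult: "mat c *v v = c *s v"
  for v :: "'a::field^'n"
proof -
  have "(\<Sum>j\<in>UNIV. (if i = j then c else 0) * v $ j) = c * v $ i" for i
    by (simp add: if_distrib[of "\<lambda>x. x * _"] cong: if_cong)
  then show ?thesis
    by (simp add: mat_def matrix_vector_mult_def vec_eq_iff)
qed

lemma shifted_BA_matrix_mult:
  "shifted_BA_matrix A B \<alpha> \<omega> *v x = (1 - \<alpha> * \<omega>) *\<^sub>R x - \<omega> *\<^sub>R (B *v (A *v x))"
  by (simp add: shifted_BA_matrix_def matrix_vector_mult_diff_rdistrib mat_vector_mult
      scalar_mult_eq_scaleR scaleR_matrix_vector_assoc matrix_vector_mul_assoc)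

lemma complex_shifted_BA_matrix_mult:
  "complex_matrix (shifted_BA_matrix A B \<alpha> \<omega>) *v v =
     of_real (1 - \<alpha> * \<omega>) *s v - of_real \<omega> *s (complex_matrix (B ** A) *v v)"
proof -
  have "complex_matrix (shifted_BA_matrix A B \<alpha> \<omega>) =
      mat (of_real (1 - \<alpha> * \<omega>)) - map_matrix (\<lambda>x. of_real (\<omega> * x)) (B ** A)"
    by (simp add: shifted_BA_matrix_def vec_eq_iff mat_def)
  moreover have "map_matrix (\<lambda>x. of_real (\<omega> * x)) (B ** A) *v v =
      of_real \<omega> *s (complex_matrix (B ** A) *v v)"
    by (simp add: vec_eq_iff matrix_vector_mult_def sum_distrib_left mult.assoc)
  ultimately show ?thesis
    by (simp only: matrix_vector_mult_diff_rdistrib mat_vector_mult)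
qed

lemma shifted_BA_matrix_eigenvector_iff:
  assumes "\<omega> \<noteq> 0"
  shows "complex_matrix (shifted_BA_matrix A B \<alpha> \<omega>) *v v = (1 - of_real \<omega> * (l + of_real \<alpha>)) *s v \<longleftrightarrow>
    complex_matrix (B ** A) *v v = l *s v"
proof -
  have "complex_matrix (shifted_BA_matrix A B \<alpha> \<omega>) *v v - (1 - of_real \<omega> * (l + of_real \<alpha>)) *s v =
      of_real \<omega> *s (l *s v - complex_matrix (B ** A) *v v)"
    unfolding complex_shifted_BA_matrix_mult by (simp add: vec_eq_iff algebra_simps)
  then show ?thesis
    using assms by (metis eq_iff_diff_eq_0 of_real_eq_0_iff vec.scale_eq_0_iff)
qed

lemma shifted_BA_matrix_eigenvalue_iff:
  assumes "\<omega> \<noteq> 0"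
  shows "eigenvalue (complex_matrix (shifted_BA_matrix A B \<alpha> \<omega>)) (1 - of_real \<omega> * (l + of_real \<alpha>)) \<longleftrightarrow>
    eigenvalue (complex_matrix (B ** A)) l"
  unfolding eigenvalue_def shifted_BA_matrix_eigenvector_iff[OF assms] ..

lemma shifted_BA_matrix_semisimple:
  assumes "\<omega> \<noteq> 0"
    and "semisimple_eigenvalue (complex_matrix (B ** A)) (of_real (- \<alpha>))"
  shows "semisimple_eigenvalue (complex_matrix (shifted_BA_matrix A B \<alpha> \<omega>)) 1"
proof -
  have eq: "(complex_matrix (shifted_BA_matrix A B \<alpha> \<omega>) - mat 1) *v v =
      (- of_real \<omega>) *s ((complex_matrix (B ** A) - mat (of_real (- \<alpha>))) *v v)" for v
    unfolding matrix_vector_mult_diff_rdistrib mat_vector_mult complex_shifted_BA_matrix_mult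
    by (simp add: vec_eq_iff algebra_simps)
  show ?thesis
    using assms shifted_BA_matrix_eigenvalue_iff[OF assms(1), of A B \<alpha> "of_real (- \<alpha>)"]
    unfolding semisimple_eigenvalue_def eq by (simp add: vec.scale vec.neg)
qed

lemma shifted_BA_step_eq:
  "shifted_BA_step A B b \<alpha> \<omega> x = shifted_BA_matrix A B \<alpha> \<omega> *v x + \<omega> *\<^sub>R (B *v b)"
  by (simp add: shifted_BA_step_def shifted_BA_matrix_mult matrix_vector_mult_diff_distrib
      scaleR_diff_right)

lemma shifted_BA_eq_orbit:
  assumes "shifted_BA_fixed_point A B b \<alpha> \<omega> x"
  shows "shifted_BA A B b \<alpha> \<omega> (x + e) k = x + orbit (shifted_BA_matrix A B \<alpha> \<omega>) e k"
  using assms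
  by (induction k)
     (simp_all add: shifted_BA_fixed_point_def shifted_BA_step_eq matrix_vector_right_distrib)

lemma shifted_BA_limit_fixed_point:
  assumes lim: "shifted_BA A B b \<alpha> \<omega> x0 \<longlonglongrightarrow> x"
  shows "shifted_BA_fixed_point A B b \<alpha> \<omega> x"
proof -
  have "(\<lambda>k. shifted_BA_step A B b \<alpha> \<omega> (shifted_BA A B b \<alpha> \<omega> x0 k)) \<longlonglongrightarrow> shifted_BA_step A B b \<alpha> \<omega> x"
    unfolding shifted_BA_step_eq
    by (intro tendsto_intros bounded_linear.tendsto[OF matrix_vector_mul_bounded_linear] lim)
  moreover have "(\<lambda>k. shifted_BA_step A B b \<alpha> \<omega> (shifted_BA A B b \<alpha> \<omega> x0 k)) \<longlonglongrightarrow> x"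
    using LIMSEQ_Suc[OF lim] by simp
  ultimately show ?thesis
    unfolding shifted_BA_fixed_point_def using LIMSEQ_unique by blast
qed

text \<open>
  If \<open>-\<alpha>\<close> is not an eigenvalue of \<open>B A\<close>, then \<open>1\<close> is not an eigenvalue of the iteration matrix
  \<open>G\<close>, so \<open>G - I\<close> is injective, hence onto, and the fixed point equation is solvable. The
  eigenvalue is excluded over the complex numbers only, so a real null vector of \<open>G - I\<close> is read
  as a complex one.
\<close>
lemma shifted_BA_fixed_point_exists:
  assumes \<omega>: "\<omega> \<noteq> 0"
    and no_eigenvalue: "\<not> eigenvalue (complex_matrix (B ** A)) (of_real (- \<alpha>))"
  shows "\<exists>x. shifted_BA_fixed_point A B b \<alpha> \<omega> x"
proof -
  let ?G = "shifted_BA_matrix A B \<alpha> \<omega>"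
  have "x = 0" if "?G *v x - 1 *s x = 0" for x
  proof -
    let ?z = "\<chi> i. complex_of_real (x $ i)"
    have "complex_matrix ?G *v ?z = (\<chi> i. complex_of_real ((?G *v x) $ i))"
      by (simp add: vec_eq_iff matrix_vector_mult_def)
    also have "\<dots> = 1 *s ?z"
      using that by simp
    finally have "?z = 0"
      using no_eigenvalue shifted_BA_matrix_eigenvalue_iff[OF \<omega>, of A B \<alpha> "of_real (- \<alpha>)"]
      by (auto simp: eigenvalue_def)
    then show "x = 0"
      by (simp add: vec_eq_iff)
  qed
  then have "(\<lambda>x. ?G *v x - 1 *s x) ` UNIV = UNIV"
    by (intro injective_on_invariant_subspace_imp_onto linear_matrix_minus_scalar) auto
  then obtain x where "- (\<omega> *\<^sub>R (B *v b)) = ?G *v x - x"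
    by (metis (no_types, lifting) UNIV_I imageE vector_smult_lid)
  then have "x = ?G *v x + \<omega> *\<^sub>R (B *v b)"
    by (simp add: algebra_simps)
  then show ?thesis
    unfolding shifted_BA_fixed_point_def shifted_BA_step_eq by blast
qed

text \<open>
  With \<open>\<mu> = l + \<alpha>\<close>, the denominator is \<open>\<bar>\<mu>\<bar>\<^sup>2 > 0\<close>, and
  \<open>\<bar>1 - \<omega> \<mu>\<bar>\<^sup>2 = 1 - \<omega> (2 Re \<mu> - \<omega> \<bar>\<mu>\<bar>\<^sup>2)\<close>. So the left side means \<open>\<omega> \<bar>\<mu>\<bar>\<^sup>2 < 2 Re \<mu>\<close>, which
  also makes \<open>Re \<mu>\<close> positive.
\<close>
lemma iteration_eigenvalue_in_unit_disc_iff: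
  assumes "\<omega> > 0" and "l \<noteq> complex_of_real (- \<alpha>)"
  shows "cmod (1 - of_real \<omega> * (l + of_real \<alpha>)) < 1 \<longleftrightarrow>
    \<omega> < 2 * ((Re l + \<alpha>) / ((cmod l)\<^sup>2 + \<alpha> * (\<alpha> + 2 * Re l))) \<and> Re l + \<alpha> > 0"
proof -
  let ?D = "(cmod l)\<^sup>2 + \<alpha> * (\<alpha> + 2 * Re l)"
  have D: "?D = (Re l + \<alpha>)\<^sup>2 + (Im l)\<^sup>2"
    unfolding cmod_power2 by (simp add: power2_eq_square algebra_simps)
  have "Re l + \<alpha> \<noteq> 0 \<or> Im l \<noteq> 0"
    using assms(2) by (auto simp: complex_eq_iff)
  then have "?D > 0"
    unfolding D by (simp add: sum_power2_gt_zero_iff)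
  have "(cmod (1 - of_real \<omega> * (l + of_real \<alpha>)))\<^sup>2 = 1 - \<omega> * (2 * (Re l + \<alpha>) - \<omega> * ?D)"
    unfolding D cmod_power2 by (simp add: power2_eq_square algebra_simps)
  moreover have "cmod (1 - of_real \<omega> * (l + of_real \<alpha>)) < 1 \<longleftrightarrow>
      (cmod (1 - of_real \<omega> * (l + of_real \<alpha>)))\<^sup>2 < 1"
    by (simp add: power_less_one_iff abs_square_less_1)
  ultimately have "cmod (1 - of_real \<omega> * (l + of_real \<alpha>)) < 1 \<longleftrightarrow> \<omega> * ?D < 2 * (Re l + \<alpha>)"
    using assms(1) by (simp add: zero_less_mult_iff)
  moreover have "\<omega> * ?D > 0"
    using assms(1) \<open>?D > 0\<close> by simp
  ultimately show ?thesis
    using \<open>?D > 0\<close> by (auto simp: pos_less_divide_eq)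
qed

theorem theorem3p1:
  fixes A :: "real^'n^'m" and B :: "real^'m^'n" and b :: "real^'m" and \<alpha> \<omega> :: real
  assumes "\<alpha> > 0" and "\<omega> > 0"
    and "eigenvalue (complex_matrix (B ** A)) (complex_of_real (- \<alpha>)) \<Longrightarrow>
           semisimple_eigenvalue (complex_matrix (B ** A)) (complex_of_real (- \<alpha>)) \<and>
           (\<exists>x. shifted_BA_fixed_point A B b \<alpha> \<omega> x)"
  shows "(\<forall>x0. \<exists>x. shifted_BA_fixed_point A B b \<alpha> \<omega> x \<and> shifted_BA A B b \<alpha> \<omega> x0 \<longlonglongrightarrow> x) \<longleftrightarrow>
    (\<forall>l. eigenvalue (complex_matrix (B ** A)) l \<and> l \<noteq> complex_of_real (- \<alpha>) \<longrightarrow>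
       0 < \<omega> \<and>
       \<omega> < 2 * ((Re l + \<alpha>) / ((cmod l)\<^sup>2 + \<alpha> * (\<alpha> + 2 * Re l))) \<and>
       Re l + \<alpha> > 0)"
proof -
  define T where "T = complex_matrix (shifted_BA_matrix A B \<alpha> \<omega>)"
  have \<omega>: "\<omega> \<noteq> 0"
    using assms(2) by simp
  obtain x where x: "shifted_BA_fixed_point A B b \<alpha> \<omega> x"
    using assms(3) shifted_BA_fixed_point_exists[OF \<omega>] by blast
  have iterates: "shifted_BA A B b \<alpha> \<omega> (x + Re_vec z) k = x + Re_vec (orbit T z k)" for z k
    unfolding T_def Re_vec_orbit by (rule shifted_BA_eq_orbit[OF x])
  have "(\<forall>x0. \<exists>x. shifted_BA_fixed_point A B b \<alpha> \<omega> x \<and> shifted_BA A B b \<alpha> \<omega> x0 \<longlonglongrightarrow> x) \<longleftrightarrow>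
    (\<forall>l. eigenvalue (complex_matrix (B ** A)) l \<and> l \<noteq> complex_of_real (- \<alpha>) \<longrightarrow>
       cmod (1 - of_real \<omega> * (l + of_real \<alpha>)) < 1)" (is "?conv \<longleftrightarrow> ?spec")
  proof
    assume conv: ?conv
    have Re_convergent: "convergent (\<lambda>k. Re_vec (orbit T z k))" for z
    proof -
      obtain y where "shifted_BA A B b \<alpha> \<omega> (x + Re_vec z) \<longlonglongrightarrow> y"
        using conv by blast
      then have "(\<lambda>k. x + Re_vec (orbit T z k) - x) \<longlonglongrightarrow> y - x"
        unfolding iterates by (intro tendsto_diff tendsto_const)
      then show ?thesis
        by (auto simp: convergent_def)
    qed
    show ?spec
    proof (intro allI impI, elim conjE)
      fix l assume l: "eigenvalue (complex_matrix (B ** A)) l" "l \<noteq> complex_of_real (- \<alpha>)"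
      define m where "m = 1 - of_real \<omega> * (l + of_real \<alpha>)"
      have "eigenvalue T m"
        unfolding T_def m_def using shifted_BA_matrix_eigenvalue_iff[OF \<omega>] l(1) by blast
      then obtain v i where v: "T *v v = m *s v" "v $ i \<noteq> 0"
        unfolding eigenvalue_def by (auto simp: vec_eq_iff)
      \<comment> \<open>Convergence is known only for real parts of orbits. Scaling the eigenvector so that its
        \<open>i\<close>-th entry is \<open>c\<close> and taking \<open>c = 1\<close> and \<open>c = -\<i>\<close> yields both parts of \<open>m\<^sup>k\<close>.\<close>
      have power: "convergent (\<lambda>k. Re (m ^ k * c))" for c
      proof -
        have "T *v ((c / v $ i) *s v) = m *s ((c / v $ i) *s v)"
          using v(1) by (simp add: vec.scale vector_smult_assoc mult.commute)
        then have "Re_vec (orbit T ((c / v $ i) *s v) k) $ i = Re (m ^ k * c)" for k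
          using v(2) by (simp add: orbit_eigenvector[of T _ m] Re_vec_def del: vector_smult_assoc)
        moreover obtain y where "(\<lambda>k. Re_vec (orbit T ((c / v $ i) *s v) k)) \<longlonglongrightarrow> y"
          using Re_convergent by (auto simp: convergent_def)
        ultimately show ?thesis
          using tendsto_vec_nth[of _ y sequentially i] by (fastforce simp: convergent_def)
      qed
      have "convergent (\<lambda>k. m ^ k)"
        using power[of 1] power[of "- \<i>"]
        by (auto simp: convergent_def tendsto_complex_iff intro: exI[of _ "Complex _ _"])
      moreover have "m \<noteq> 1"
        using \<omega> l(2) by (auto simp: m_def add_eq_0_iff2)
      ultimately show "cmod (1 - of_real \<omega> * (l + of_real \<alpha>)) < 1"
        using convergent_power_cases m_def by blast
    qed
  next
    assume spec: ?spec
    have "convergent (orbit T z)" for z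
    proof (rule orbits_convergent)
      fix m assume m: "eigenvalue T m"
      define l where "l = (1 - m) / of_real \<omega> - of_real \<alpha>"
      have m_eq: "m = 1 - of_real \<omega> * (l + of_real \<alpha>)"
        using \<omega> by (simp add: l_def)
      with m have "eigenvalue (complex_matrix (B ** A)) l"
        unfolding T_def using shifted_BA_matrix_eigenvalue_iff[OF \<omega>] by blast
      then show "m = 1 \<or> cmod m < 1"
        using spec m_eq by (cases "l = of_real (- \<alpha>)") auto
    next
      assume "eigenvalue T 1"
      then have "eigenvalue (complex_matrix (B ** A)) (of_real (- \<alpha>))"
        using shifted_BA_matrix_eigenvalue_iff[OF \<omega>, of A B \<alpha> "of_real (- \<alpha>)"]
        by (simp add: T_def)
      then show "semisimple_eigenvalue T 1"
        unfolding T_def using assms(3) shifted_BA_matrix_semisimple[OF \<omega>] by blast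
    qed
    then have orbit_limit: "\<exists>L. orbit T z \<longlonglongrightarrow> L" for z
      by (simp add: convergent_def)
    show ?conv
    proof
      fix x0
      define z where "z = (\<chi> i. complex_of_real ((x0 - x) $ i))"
      obtain L where "orbit T z \<longlonglongrightarrow> L"
        using orbit_limit by blast
      then have "(\<lambda>k. x + Re_vec (orbit T z k)) \<longlonglongrightarrow> x + Re_vec L"
        by (intro tendsto_intros tendsto_Re_vec)
      moreover have "x + Re_vec z = x0"
        unfolding z_def Re_vec_of_real by simp
      ultimately have "shifted_BA A B b \<alpha> \<omega> x0 \<longlonglongrightarrow> x + Re_vec L"
        by (simp add: iterates[of z, symmetric])
      then show "\<exists>y. shifted_BA_fixed_point A B b \<alpha> \<omega> y \<and> shifted_BA A B b \<alpha> \<omega> x0 \<longlonglongrightarrow> y"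
        using shifted_BA_limit_fixed_point by blast
    qed
  qed
  then show ?thesis
    using assms(2) iteration_eigenvalue_in_unit_disc_iff[OF assms(2)] by blast
qed

end
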